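(* Let $a,b\in\mathbb R$ be constants with $b\ne 0$. Let $v:\mathbb R^3\to\mathbb R^3$ be a $C^2(\mathbb R^3)$ vector field which, together with some (differentiable) scalar function $p:\mathbb R^3\to\mathbb R$, solves on $\mathbb R^3$ the system $$(v\cdot\nabla)v=-\nabla p+a\,v+b\,(x\cdot\nabla)v,\qquad \operatorname{div} v=0.$$ Let $\omega=\operatorname{curl} v$, and suppose that $$\|\nabla v\|_{L^\infty(\mathbb R^3)}<\infty\qquad\text{and}\qquad \omega\in\bigcup_{r>0}\ \bigcap_{0<q<r}L^q(\mathbb R^3).$$ Then $v=\nabla h$ for some harmonic scalar function $h$ on $\mathbb R^3$. Consequently, if in addition $\lim_{|x|\to\infty}|v(x)|=0$, then $v=0$ on $\mathbb R^3$.
   Context: $(v\cdot\nabla)v$ has components $\sum_{j=1}^3 v_j\partial_jv_i$, and $(x\cdot\nabla)v$ has components $\sum_{j=1}^3 x_j\partial_jv_i$. For $0<q<\infty$ (including $q<1$), $\omega\in L^q(\mathbb R^3)$ means $\int_{\mathbb R^3}|\omega|^q\,dx<\infty$; thus the condition on $\omega$ says that there exists $r>0$ such that $\int_{\mathbb R^3}|\omega|^q\,dx<\infty$ for every $q\in(0,r)$. *)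

theory Defs
  imports "HOL-Analysis.Analysis" "HOL-Probability.Essential_Supremum"
begin

definition partial_deriv :: "'n \<Rightarrow> (real ^ 'n \<Rightarrow> real) \<Rightarrow> real ^ 'n \<Rightarrow> real" where
  "partial_deriv i f x = deriv (\<lambda>t. f (x + t *\<^sub>R axis i 1)) 0"

(* The class C^k on the whole space. Total differentiability at the intermediate orders is not an
   extra requirement: it follows from continuity of the partial derivatives. *)
primrec Ck :: "nat \<Rightarrow> (real ^ 'n \<Rightarrow> real) \<Rightarrow> bool" where
  "Ck 0 f \<longleftrightarrow> continuous_on UNIV f"
| "Ck (Suc k) f \<longleftrightarrow> f differentiable_on UNIV \<and> (\<forall>i. Ck k (partial_deriv i f))"

definition Ck_field :: "nat \<Rightarrow> (real ^ 'n \<Rightarrow> real ^ 'm) \<Rightarrow> bool" where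
  "Ck_field k v \<longleftrightarrow> (\<forall>i. Ck k (\<lambda>x. v x $ i))"

definition grad :: "(real ^ 'n \<Rightarrow> real) \<Rightarrow> real ^ 'n \<Rightarrow> real ^ 'n" where
  "grad f x = (\<chi> i. partial_deriv i f x)"

(* The norm on real ^ 'n ^ 'm is the Frobenius norm. *)
definition grad_field :: "(real ^ 'n \<Rightarrow> real ^ 'm) \<Rightarrow> real ^ 'n \<Rightarrow> real ^ 'n ^ 'm" where
  "grad_field v x = (\<chi> i j. partial_deriv j (\<lambda>y. v y $ i) x)"

definition div_field :: "(real ^ 'n \<Rightarrow> real ^ 'n) \<Rightarrow> real ^ 'n \<Rightarrow> real" where
  "div_field v x = (\<Sum>i\<in>UNIV. partial_deriv i (\<lambda>y. v y $ i) x)"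

definition curl :: "(real ^ 3 \<Rightarrow> real ^ 3) \<Rightarrow> real ^ 3 \<Rightarrow> real ^ 3" where
  "curl v x = vector
     [partial_deriv 2 (\<lambda>y. v y $ 3) x - partial_deriv 3 (\<lambda>y. v y $ 2) x,
      partial_deriv 3 (\<lambda>y. v y $ 1) x - partial_deriv 1 (\<lambda>y. v y $ 3) x,
      partial_deriv 1 (\<lambda>y. v y $ 2) x - partial_deriv 2 (\<lambda>y. v y $ 1) x]"

(* (u . nabla) v; the position field x is the identity function. *)
definition advect ::
  "(real ^ 'n \<Rightarrow> real ^ 'n) \<Rightarrow> (real ^ 'n \<Rightarrow> real ^ 'm) \<Rightarrow> real ^ 'n \<Rightarrow> real ^ 'm" where
  "advect u v x = (\<chi> i. \<Sum>j\<in>UNIV. u x $ j * partial_deriv j (\<lambda>y. v y $ i) x)"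

definition laplacian :: "(real ^ 'n \<Rightarrow> real) \<Rightarrow> real ^ 'n \<Rightarrow> real" where
  "laplacian f x = (\<Sum>i\<in>UNIV. partial_deriv i (partial_deriv i f) x)"

definition harmonic :: "(real ^ 'n \<Rightarrow> real) \<Rightarrow> bool" where
  "harmonic h \<longleftrightarrow> Ck 2 h \<and> (\<forall>x. laplacian h x = 0)"

(* Meant for 0 < q < infinity, including q < 1, where it is not a normed space. *)
definition Lq :: "real \<Rightarrow> (real ^ 'n \<Rightarrow> real ^ 'm) set" where
  "Lq q = {f \<in> borel_measurable lebesgue. integrable lebesgue (\<lambda>x. norm (f x) powr q)}"

end

(*
  Write A k i = d_k v_i and W = A - A^T (the entries of W are those of the vorticity up to sign).
  Taking the curl of the equation eliminates p and gives, for u = v - b x,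
     (u . grad) W = (a + b) W - (A W + W A^T),
  so s = |W|^2 satisfies |u . grad s| <= C s with a constant C depending only on a, b and the bound
  on grad v. Since div u = -3 b, integrating div (s^theta u) over the space gives
     3 |b| int s^theta <= theta C int s^theta,
  which forces s = 0 when theta is small. The integration by parts is justified by a cutoff at
  |x| <= n, whose gradient is O(1/n) while u grows at most linearly: dominated convergence applies.
  A curl-free v is a gradient, its potential is harmonic because div v = 0, and the components of v
  are harmonic as well, so decay at infinity and the maximum principle give v = 0.
*)
theory Submission
  imports Defs
begin

section \<open>Partial derivatives and their symmetry\<close>

lemma partial_deriv_has_derivative:
  fixes f :: "real ^ 'n \<Rightarrow> real"
  assumes "(f has_derivative D) (at x)"
  shows "partial_deriv i f x = D (axis i 1)"
proof -
  have lin: "D (t *\<^sub>R axis i 1) = t * D (axis i 1)" for t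
    using linear_scale[OF has_derivative_linear[OF assms]] by simp
  have "(f has_derivative D) (at (x + 0 *\<^sub>R axis i 1))"
    using assms by simp
  then have "((\<lambda>t. f (x + t *\<^sub>R axis i 1)) has_derivative (\<lambda>t. D (t *\<^sub>R axis i 1))) (at 0)"
    by (rule has_derivative_compose[rotated]) (auto intro!: derivative_eq_intros)
  then have "((\<lambda>t. f (x + t *\<^sub>R axis i 1)) has_field_derivative D (axis i 1)) (at 0)"
    unfolding has_field_derivative_def lin by (simp add: mult_commute_abs)
  then show ?thesis
    unfolding partial_deriv_def by (rule DERIV_imp_deriv)
qed

lemma has_derivative_partial_deriv:
  fixes f :: "real ^ 'n \<Rightarrow> real"
  assumes "f differentiable (at x)"
  shows "(f has_derivative (\<lambda>h. \<Sum>i\<in>UNIV. h $ i * partial_deriv i f x)) (at x)"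
proof -
  obtain D where D: "(f has_derivative D) (at x)"
    using assms by (auto simp: differentiable_def)
  have lin: "linear D"
    by (rule has_derivative_linear[OF D])
  have "D h = (\<Sum>i\<in>UNIV. h $ i * partial_deriv i f x)" for h
  proof -
    have "D h = D (\<Sum>i\<in>UNIV. h $ i *\<^sub>R axis i 1)"
      by (simp add: basis_expansion flip: scalar_mult_eq_scaleR)
    also have "\<dots> = (\<Sum>i\<in>UNIV. h $ i * partial_deriv i f x)"
      using lin by (simp add: linear_sum linear_scale partial_deriv_has_derivative[OF D])
    finally show ?thesis .
  qed
  then have "D = (\<lambda>h. \<Sum>i\<in>UNIV. h $ i * partial_deriv i f x)"
    by blast
  with D show ?thesis by simp
qed

lemma DERIV_along_axis:
  fixes f :: "real ^ 'n \<Rightarrow> real"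
  assumes "\<And>x. f differentiable (at x)"
  shows "((\<lambda>t. f (x + t *\<^sub>R axis i 1)) has_real_derivative
           partial_deriv i f (x + t *\<^sub>R axis i 1)) (at t)"
proof -
  let ?y = "x + t *\<^sub>R axis i 1"
  have "((\<lambda>t. f (x + t *\<^sub>R axis i 1)) has_derivative
      (\<lambda>s. \<Sum>k\<in>UNIV. (s *\<^sub>R axis i 1 :: real^'n) $ k * partial_deriv k f ?y)) (at t)"
    by (rule has_derivative_compose[OF _ has_derivative_partial_deriv[OF assms]])
       (auto intro!: derivative_eq_intros)
  moreover have "(\<Sum>k\<in>UNIV. (s *\<^sub>R axis i 1 :: real^'n) $ k * partial_deriv k f ?y)
      = s * partial_deriv i f ?y" for s
    by (simp add: axis_def if_distrib if_distribR cong: if_cong)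
  ultimately show ?thesis
    by (simp add: has_field_derivative_def mult_commute_abs)
qed

text \<open>The mean value theorem is applied twice: along \<open>axis i 1\<close> to the increment
  of \<open>f\<close> in direction \<open>j\<close>, then along \<open>axis j 1\<close> to
  \<open>partial_deriv i f\<close>. The point of this form is that the left side is symmetric in
  \<open>i\<close> and \<open>j\<close>.\<close>

lemma second_difference_mean_value:
  fixes f :: "real ^ 'n \<Rightarrow> real"
  assumes f: "\<And>x. f differentiable (at x)"
    and f': "\<And>x. partial_deriv i f differentiable (at x)"
    and "r > 0"
  obtains s t where "0 < s" "s < r" "0 < t" "t < r"
    "f (x + r *\<^sub>R axis i 1 + r *\<^sub>R axis j 1) - f (x + r *\<^sub>R axis i 1) - f (x + r *\<^sub>R axis j 1) + f x
      = r * r * partial_deriv j (partial_deriv i f) (x + s *\<^sub>R axis i 1 + t *\<^sub>R axis j 1)"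
proof -
  let ?g = "\<lambda>s. f ((x + r *\<^sub>R axis j 1) + s *\<^sub>R axis i 1) - f (x + s *\<^sub>R axis i 1)"
  have "\<exists>s. 0 < s \<and> s < r \<and> ?g r - ?g 0 = (r - 0) *
      (partial_deriv i f ((x + r *\<^sub>R axis j 1) + s *\<^sub>R axis i 1) - partial_deriv i f (x + s *\<^sub>R axis i 1))"
    using \<open>r > 0\<close> by (intro MVT2 DERIV_diff DERIV_along_axis f)
  then obtain s where s: "0 < s" "s < r" "?g r - ?g 0 = r *
      (partial_deriv i f (x + s *\<^sub>R axis i 1 + r *\<^sub>R axis j 1) - partial_deriv i f (x + s *\<^sub>R axis i 1))"
    by (auto simp: ac_simps)
  let ?h = "\<lambda>t. partial_deriv i f ((x + s *\<^sub>R axis i 1) + t *\<^sub>R axis j 1)"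
  have "\<exists>t. 0 < t \<and> t < r \<and> ?h r - ?h 0 = (r - 0) *
      partial_deriv j (partial_deriv i f) ((x + s *\<^sub>R axis i 1) + t *\<^sub>R axis j 1)"
    using \<open>r > 0\<close> by (intro MVT2 DERIV_along_axis f')
  then obtain t where "0 < t" "t < r" "?h r - ?h 0 = r *
      partial_deriv j (partial_deriv i f) ((x + s *\<^sub>R axis i 1) + t *\<^sub>R axis j 1)"
    by auto
  with s show ?thesis
    by (intro that[of s t]) (auto simp: algebra_simps)
qed

text \<open>Schwarz's theorem. By continuity, the second difference quotient
  \<open>?D i j n / (?r n * ?r n)\<close> tends to the mixed derivative taken first in
  \<open>i\<close>, then in \<open>j\<close>; since the quotient does not change when
  \<open>i\<close> and \<open>j\<close> are interchanged, uniqueness of limits gives the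
  equality.\<close>

lemma partial_deriv_commute:
  fixes f :: "real ^ 'n \<Rightarrow> real"
  assumes f: "\<And>x. f differentiable (at x)"
    and f': "\<And>i x. partial_deriv i f differentiable (at x)"
    and f'': "\<And>i j. continuous_on UNIV (partial_deriv j (partial_deriv i f))"
  shows "partial_deriv i (partial_deriv j f) x = partial_deriv j (partial_deriv i f) x"
proof -
  let ?r = "\<lambda>n. 1 / real (Suc n)"
  let ?p = "\<lambda>i j s t. x + s *\<^sub>R axis i 1 + t *\<^sub>R axis j (1::real)"
  let ?D = "\<lambda>i j n. f (x + ?r n *\<^sub>R axis i 1 + ?r n *\<^sub>R axis j 1)
      - f (x + ?r n *\<^sub>R axis i 1) - f (x + ?r n *\<^sub>R axis j 1) + f x"
  have lim: "(\<lambda>n. ?D i j n / (?r n * ?r n)) \<longlonglongrightarrow> partial_deriv j (partial_deriv i f) x" for i j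
  proof -
    have "\<exists>s t. 0 < s \<and> s < ?r n \<and> 0 < t \<and> t < ?r n \<and>
        ?D i j n = ?r n * ?r n * partial_deriv j (partial_deriv i f) (?p i j s t)" for n
    proof (rule second_difference_mean_value[OF f f', of "?r n"])
      show "0 < ?r n" by simp
    qed blast
    then obtain s t where st: "\<And>n. 0 < s n \<and> s n < ?r n \<and> 0 < t n \<and> t n < ?r n \<and>
        ?D i j n = ?r n * ?r n * partial_deriv j (partial_deriv i f) (?p i j (s n) (t n))"
      by metis
    have r: "?r \<longlonglongrightarrow> 0"
      using LIMSEQ_inverse_real_of_nat by (simp add: inverse_eq_divide)
    have "s \<longlonglongrightarrow> 0" "t \<longlonglongrightarrow> 0"
      by (rule tendsto_sandwich[OF _ _ tendsto_const r],
          insert st, auto intro!: always_eventually less_imp_le)+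
    then have "(\<lambda>n. ?p i j (s n) (t n)) \<longlonglongrightarrow> ?p i j 0 0"
      by (intro tendsto_intros)
    then have "(\<lambda>n. partial_deriv j (partial_deriv i f) (?p i j (s n) (t n)))
        \<longlonglongrightarrow> partial_deriv j (partial_deriv i f) (?p i j 0 0)"
      by (rule continuous_on_tendsto_compose[OF f'']) auto
    moreover have "?D i j n / (?r n * ?r n) = partial_deriv j (partial_deriv i f) (?p i j (s n) (t n))" for n
      using st[of n] by simp
    ultimately show ?thesis by simp
  qed
  have "(\<lambda>n. ?D i j n / (?r n * ?r n)) = (\<lambda>n. ?D j i n / (?r n * ?r n))"
    by (simp add: algebra_simps)
  with lim[of j i] have "(\<lambda>n. ?D i j n / (?r n * ?r n)) \<longlonglongrightarrow> partial_deriv i (partial_deriv j f) x"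
    by (simp only:)
  from LIMSEQ_unique[OF this lim[of i j]] show ?thesis .
qed

section \<open>Integrals of derivatives of compactly supported functions\<close>

text \<open>The directional derivative is the limit of difference quotients along \<open>e\<close>.
  The mean value theorem bounds these by a constant on one fixed ball and by zero outside it, so
  dominated convergence carries their vanishing integrals to the limit. Summed over a basis, this is
  the divergence theorem without boundary term.\<close>

lemma integral_derivative_compact_support_eq_0:
  fixes f :: "'a::euclidean_space \<Rightarrow> real"
  assumes f: "\<And>x. (f has_derivative f' x) (at x)"
    and cont: "continuous_on UNIV (\<lambda>x. f' x e)"
    and supp: "\<And>x. norm x > R \<Longrightarrow> f x = 0"
  shows "integrable lborel (\<lambda>x. f' x e)" and "(\<integral>x. f' x e \<partial>lborel) = 0"
proof -
  have cf: "continuous_on UNIV f"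
    using f by (meson continuous_at_imp_continuous_on has_derivative_continuous)
  have [measurable]: "f \<in> borel_measurable borel" "(\<lambda>x. f' x e) \<in> borel_measurable borel"
    using cf cont by (auto intro: borel_measurable_continuous_onI)
  have f'0: "f' x e = 0" if "norm x > R" for x
  proof -
    have "open {y::'a. norm y > R}"
      by (intro open_Collect_less continuous_intros)
    then have "(f has_derivative (\<lambda>_. 0)) (at x)"
      by (rule has_derivative_transform_within_open[OF has_derivative_const[of 0]])
         (use that supp in auto)
    then show ?thesis
      using has_derivative_unique[OF f[of x]] by simp
  qed
  have "bounded ((\<lambda>x. f' x e) ` cball 0 R)"
    by (intro compact_imp_bounded compact_continuous_image continuous_on_subset[OF cont]) auto
  then obtain B0 where "\<And>x. norm x \<le> R \<Longrightarrow> \<bar>f' x e\<bar> \<le> B0"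
    unfolding bounded_iff by force
  then have B: "\<bar>f' x e\<bar> \<le> max 0 B0" for x
    using f'0[of x] by (cases "norm x \<le> R") (auto simp: le_max_iff_disj)
  define B where "B = max 0 B0"
  define h where "h n = 1 / real (Suc n)" for n
  have h: "0 < h n" "h n \<le> 1" for n
    by (auto simp: h_def)
  have h0: "h \<longlonglongrightarrow> 0"
    unfolding h_def using LIMSEQ_inverse_real_of_nat by (simp add: inverse_eq_divide)
  \<comment> \<open>As \<open>h n \<le> 1\<close>, the quotient at \<open>x\<close> equals
    \<open>f' y e\<close> for some \<open>y\<close> within distance \<open>norm e\<close> of
    \<open>x\<close>; it therefore vanishes outside \<open>S\<close>.\<close>
  define S where "S = cball (0::'a) (R + norm e)"
  let ?w = "\<lambda>x. B * indicator S x"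
  have iw: "integrable lborel ?w"
    by (rule integrable_mult_right)
       (use emeasure_lborel_cball_finite[of "0::'a" "R + norm e"] in
          \<open>simp add: S_def integrable_indicator_iff\<close>)
  let ?g = "\<lambda>n x. (f (x + h n *\<^sub>R e) - f x) / h n"
  have deriv1: "((\<lambda>t. f (x + t *\<^sub>R e)) has_real_derivative f' (x + t *\<^sub>R e) e) (at t)" for x t
  proof -
    have "((\<lambda>t. f (x + t *\<^sub>R e)) has_derivative (\<lambda>s. f' (x + t *\<^sub>R e) (s *\<^sub>R e))) (at t)"
      by (rule has_derivative_compose[where f = "\<lambda>t. x + t *\<^sub>R e" and g = f])
         (auto intro!: derivative_eq_intros f)
    moreover have "f' (x + t *\<^sub>R e) (s *\<^sub>R e) = f' (x + t *\<^sub>R e) e * s" for s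
      by (simp add: linear_scale[OF has_derivative_linear[OF f]])
    ultimately show ?thesis
      by (simp add: has_field_derivative_def)
  qed
  have lim: "(\<lambda>n. ?g n x) \<longlonglongrightarrow> f' x e" for x
  proof -
    have "((\<lambda>t. (f (x + (0 + t) *\<^sub>R e) - f (x + 0 *\<^sub>R e)) / t) \<longlongrightarrow> f' x e) (at 0)"
      using deriv1[of x 0] unfolding DERIV_def by simp
    moreover have "filterlim h (at 0) sequentially"
      using h0 by (simp add: filterlim_at h_def)
    ultimately have "(\<lambda>n. (f (x + (0 + h n) *\<^sub>R e) - f (x + 0 *\<^sub>R e)) / h n) \<longlonglongrightarrow> f' x e"
      by (rule filterlim_compose)
    then show ?thesis by simp
  qed
  have bound: "\<bar>?g n x\<bar> \<le> ?w x" for n x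
  proof -
    have "\<exists>z. 0 < z \<and> z < h n \<and> f (x + h n *\<^sub>R e) - f (x + 0 *\<^sub>R e) = (h n - 0) * f' (x + z *\<^sub>R e) e"
      using h(1) by (intro MVT2 deriv1)
    then obtain z where z: "0 < z" "z < h n" "f (x + h n *\<^sub>R e) - f x = h n * f' (x + z *\<^sub>R e) e"
      by auto
    have g: "?g n x = f' (x + z *\<^sub>R e) e"
      using z h(1)[of n] by simp
    show ?thesis
    proof (cases "x \<in> S")
      case True
      then show ?thesis unfolding g using B by (simp add: B_def)
    next
      case False
      have "norm (z *\<^sub>R e) \<le> 1 * norm e"
        using z h(2)[of n] unfolding norm_scaleR by (intro mult_right_mono) auto
      moreover have "norm x \<le> norm (x + z *\<^sub>R e) + norm (z *\<^sub>R e)"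
        using norm_triangle_ineq4[of "x + z *\<^sub>R e" "z *\<^sub>R e"] by simp
      ultimately have "norm (x + z *\<^sub>R e) > R"
        using False by (simp add: S_def)
      then show ?thesis unfolding g using f'0 by (simp add: B_def)
    qed
  qed
  have ae: "AE x in lborel. norm (?g n x) \<le> ?w x" for n
    using bound by simp
  show int: "integrable lborel (\<lambda>x. f' x e)"
    by (rule integrable_dominated_convergence[OF _ _ iw AE_I2[OF lim] ae]) measurable
  \<comment> \<open>Dominated convergence for the constant sequence \<open>f\<close> serves as a
    comparison test.\<close>
  have "integrable lborel (\<lambda>x. f x)"
  proof (rule integrable_dominated_convergence)
    show "integrable lborel (\<lambda>x. \<bar>indicator (cball 0 R) x * f x\<bar>)"
      using borel_integrable_compact[of "cball 0 R" f] continuous_on_subset[OF cf]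
      by (intro integrable_abs) simp
    show "AE x in lborel. (\<lambda>n. f x) \<longlonglongrightarrow> f x" by simp
    show "AE x in lborel. norm (f x) \<le> \<bar>indicator (cball 0 R) x * f x\<bar>"
      using supp by (auto simp: indicator_def)
  qed measurable
  then have if': "integrable lborel f" by simp
  have trans: "integrable lborel (\<lambda>x. f (x + c))" "(\<integral>x. f (x + c) \<partial>lborel) = (\<integral>x. f x \<partial>lborel)" for c
  proof -
    have "integrable (distr lborel borel ((+) c)) f"
      using if' by (simp add: lborel_distr_plus)
    then show "integrable lborel (\<lambda>x. f (x + c))"
      by (subst (asm) integrable_distr_eq) (auto simp: add.commute)
    have "(\<integral>x. f x \<partial>distr lborel borel ((+) c)) = (\<integral>x. f (c + x) \<partial>lborel)"
      by (rule integral_distr) measurable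
    then show "(\<integral>x. f (x + c) \<partial>lborel) = (\<integral>x. f x \<partial>lborel)"
      by (simp add: lborel_distr_plus add.commute)
  qed
  \<comment> \<open>Translation invariance makes the integral of every difference quotient vanish.\<close>
  have zero: "(\<integral>x. ?g n x \<partial>lborel) = 0" for n
    using trans[of "h n *\<^sub>R e"] if' by (simp add: Bochner_Integration.integral_diff)
  have "(\<lambda>n. (\<integral>x. ?g n x \<partial>lborel)) \<longlonglongrightarrow> (\<integral>x. f' x e \<partial>lborel)"
    by (rule integral_dominated_convergence[OF _ _ iw AE_I2[OF lim] ae]) measurable
  then show "(\<integral>x. f' x e \<partial>lborel) = 0"
    unfolding zero by (simp add: LIMSEQ_const_iff)
qed

section \<open>Vanishing of integrable solutions of a transport inequality\<close>

text \<open>Nonempty open sets are not negligible. This turns almost-everywhere statements about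
  continuous functions into pointwise ones.\<close>

lemma AE_lebesgue_open_empty:
  fixes S :: "'a::euclidean_space set"
  assumes "open S" and "AE x in lebesgue. x \<notin> S"
  shows "S = {}"
proof -
  have "S \<in> null_sets lebesgue"
    using assms by (subst AE_iff_null_sets) auto
  then show ?thesis
    using assms(1) open_not_negligible by (auto simp: negligible_iff_null_sets)
qed

text \<open>The squared positive part supplies an explicit differentiable cutoff profile with
  continuous derivative. At the kink the difference quotient is \<open>max 0 h\<close>, which tends
  to 0.\<close>

lemma DERIV_max_0_power2: "((\<lambda>y::real. (max 0 y)\<^sup>2) has_real_derivative 2 * max 0 y) (at y)"
proof -
  consider "y > 0" | "y < 0" | "y = 0" by linarith
  then show ?thesis
  proof cases
    case 1
    have "((\<lambda>y::real. y\<^sup>2) has_real_derivative 2 * max 0 y) (at y)"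
      using 1 by (auto intro!: derivative_eq_intros)
    then show ?thesis
      by (rule has_field_derivative_transform_within_open[where S = "{0<..}"]) (use 1 in auto)
  next
    case 2
    have "((\<lambda>y::real. 0) has_real_derivative 2 * max 0 y) (at y)"
      using 2 by (auto intro!: derivative_eq_intros)
    then show ?thesis
      by (rule has_field_derivative_transform_within_open[where S = "{..<0}"]) (use 2 in auto)
  next
    case 3
    have "((\<lambda>h. max 0 h) \<longlongrightarrow> (max 0 0 :: real)) (at 0)"
      by (intro tendsto_intros)
    then have "((\<lambda>h. max 0 h) \<longlongrightarrow> (0 :: real)) (at 0)"
      by simp
    then have "((\<lambda>h. (max 0 h)\<^sup>2 / h) \<longlongrightarrow> (0::real)) (at 0)"
      by (rule Lim_transform_within[where d = 1]) (auto simp: max_def power2_eq_square)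
    then show ?thesis
      using 3 by (simp add: DERIV_def)
  qed
qed

text \<open>Subadditivity of the power with exponent \<open>t \<le> 1\<close>, which holds because
  \<open>x powr (t - 1)\<close> is nonincreasing for positive \<open>x\<close>. It bounds the
  regularised power by the original one, uniformly in \<open>d\<close>.\<close>

lemma powr_add_diff_le:
  fixes s d t :: real
  assumes "s \<ge> 0" "d > 0" "0 < t" "t \<le> 1"
  shows "(s + d) powr t - d powr t \<le> s powr t"
proof (cases "s = 0")
  case False
  with assms have "s > 0" by simp
  have split: "x powr t = x * x powr (t - 1)" if "x > 0" for x :: real
    using that powr_add[of x 1 "t - 1"] by simp
  have "(s + d) powr t = s * (s + d) powr (t - 1) + d * (s + d) powr (t - 1)"
    using split[of "s + d"] \<open>s > 0\<close> \<open>d > 0\<close> by (simp add: algebra_simps)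
  also have "\<dots> \<le> s * s powr (t - 1) + d * d powr (t - 1)"
    using \<open>s > 0\<close> assms by (intro add_mono mult_left_mono powr_mono2') auto
  also have "\<dots> = s powr t + d powr t"
    using split \<open>s > 0\<close> \<open>d > 0\<close> by simp
  finally show ?thesis by simp
qed (use assms in simp)

text \<open>
  The equation is tested with \<open>s powr \<theta>\<close>, which need not be differentiable where \<open>s\<close> vanishes; so it is
  replaced by \<open>(s + \<delta>) powr \<theta> - \<delta> powr \<theta>\<close>, and \<open>\<delta> \<rightarrow> 0\<close> together with the removal of the cutoff.
\<close>

lemma transport_powr_integrable_vanishes:
  fixes s :: "'a::euclidean_space \<Rightarrow> real" and u :: "'a \<Rightarrow> 'a"
  assumes s: "\<And>x. (s has_derivative s' x) (at x)"
    and cont_s': "\<And>h. continuous_on UNIV (\<lambda>x. s' x h)"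
    and u: "\<And>x. (u has_derivative u' x) (at x)"
    and cont_u': "\<And>h. continuous_on UNIV (\<lambda>x. u' x h)"
    and div: "\<And>x. (\<Sum>i\<in>Basis. u' x i \<bullet> i) = c"
    and nonneg: "\<And>x. 0 \<le> s x"
    and transport: "\<And>x. \<bar>s' x (u x)\<bar> \<le> C * s x"
    and growth: "\<And>x. norm (u x) \<le> K * (1 + norm x)"
    and "0 \<le> C" "0 < \<theta>" "\<theta> \<le> 1" "C * \<theta> < \<bar>c\<bar>"
    and int: "integrable lebesgue (\<lambda>x. s x powr \<theta>)"
  shows "s x = 0"
proof -
  have "0 \<le> K"
    using growth[of 0] order_trans[OF norm_ge_zero] by auto
  have cs: "continuous_on UNIV s"
    using s by (meson continuous_at_imp_continuous_on has_derivative_continuous)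
  have cu: "continuous_on UNIV u"
    using u by (meson continuous_at_imp_continuous_on has_derivative_continuous)
  have cs'u: "continuous_on UNIV (\<lambda>x. s' x (u x))"
  proof -
    have "s' x (u x) = (\<Sum>i\<in>Basis. (u x \<bullet> i) * s' x i)" for x
    proof -
      have "s' x (u x) = s' x (\<Sum>i\<in>Basis. (u x \<bullet> i) *\<^sub>R i)"
        by (simp add: euclidean_representation)
      also have "\<dots> = (\<Sum>i\<in>Basis. (u x \<bullet> i) * s' x i)"
        using has_derivative_linear[OF s[of x]] by (simp add: linear_sum linear_scale)
      finally show ?thesis .
    qed
    then show ?thesis
      by (auto intro!: continuous_intros cont_s' cu)
  qed
  have [measurable]: "s \<in> borel_measurable borel" "(\<lambda>x. s' x (u x)) \<in> borel_measurable borel"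
    using cs cs'u by (auto intro: borel_measurable_continuous_onI)
  have int': "integrable lborel (\<lambda>x. s x powr \<theta>)"
    using int by (subst (asm) integrable_completion) measurable
  define r where "r n = real (Suc n)" for n
  \<comment> \<open>One sequence serves two purposes: \<open>\<delta> n\<close> regularises the
    power, and its reciprocal \<open>r n\<close> is the radius of the cutoff.\<close>
  define \<delta> where "\<delta> n = 1 / r n" for n
  have r: "1 \<le> r n" and \<delta>: "0 < \<delta> n" for n
    by (auto simp: r_def \<delta>_def)
  have \<delta>0: "\<delta> \<longlonglongrightarrow> 0"
    unfolding \<delta>_def r_def using LIMSEQ_inverse_real_of_nat by (simp add: inverse_eq_divide)
  have s\<delta>: "0 < s x + \<delta> n" for x n
    using nonneg[of x] \<delta>[of n] by linarith
  \<comment> \<open>The square of \<open>m n\<close> is the cutoff \<open>\<phi> n\<close>: it is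
    continuously differentiable, vanishes for \<open>norm x > r n\<close> and tends to 1
    pointwise.\<close>
  define m where "m n x = max 0 (1 - x \<bullet> x * (\<delta> n)\<^sup>2)" for n and x :: 'a
  define \<phi> where "\<phi> n x = (m n x)\<^sup>2" for n x
  define \<phi>' where "\<phi>' n x h = - 4 * m n x * (x \<bullet> h) * (\<delta> n)\<^sup>2" for n and x h :: 'a
  define \<beta> where "\<beta> n x = (s x + \<delta> n) powr \<theta> - \<delta> n powr \<theta>" for n x
  define \<beta>' where "\<beta>' n x = \<theta> * (s x + \<delta> n) powr (\<theta> - 1)" for n x
  \<comment> \<open>\<open>T n\<close> is the divergence of \<open>\<phi> n x * \<beta> n x\<close>
    times \<open>u x\<close>, expanded by the product rule with \<open>c\<close> for the divergence
    of \<open>u\<close>. Its integral is therefore zero.\<close>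
  define T where "T n x = \<phi>' n x (u x) * \<beta> n x + \<phi> n x * \<beta>' n x * s' x (u x) + c * \<phi> n x * \<beta> n x" for n x
  have m01: "0 \<le> m n x" "m n x \<le> 1" for n x
    by (auto simp: m_def)
  have m0: "m n x = 0" if "norm x > r n" for n x
  proof -
    have "(r n)\<^sup>2 \<le> (norm x)\<^sup>2"
      using that r[of n] by (intro power_mono) auto
    then show ?thesis
      using r[of n] by (simp add: m_def \<delta>_def power2_norm_eq_inner field_simps)
  qed
  have \<phi>: "(\<phi> n has_derivative \<phi>' n x) (at x)" for n x
  proof -
    have "((\<lambda>x. 1 - x \<bullet> x * (\<delta> n)\<^sup>2) has_derivative (\<lambda>h. - (2 * (x \<bullet> h)) * (\<delta> n)\<^sup>2)) (at x)"
      by (auto intro!: derivative_eq_intros simp: inner_commute)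
    from DERIV_compose_FDERIV[OF DERIV_max_0_power2 this]
    show ?thesis
      unfolding \<phi>_def \<phi>'_def m_def by (simp add: algebra_simps)
  qed
  have \<beta>: "(\<beta> n has_derivative (\<lambda>h. \<beta>' n x * s' x h)) (at x)" for n x
  proof -
    have "((\<lambda>y. (y + \<delta> n) powr \<theta> - \<delta> n powr \<theta>) has_real_derivative \<beta>' n x) (at (s x))"
      unfolding \<beta>'_def using s\<delta>[of x n] by (auto intro!: derivative_eq_intros)
    from DERIV_compose_FDERIV[OF this s]
    show ?thesis
      unfolding \<beta>_def by (simp add: mult.commute)
  qed
  have c\<beta>: "continuous_on UNIV (\<beta> n)" and c\<beta>': "continuous_on UNIV (\<beta>' n)" for n
    unfolding \<beta>_def \<beta>'_def using s\<delta>[THEN less_imp_neq] 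
    by (auto intro!: continuous_intros cs simp: eq_commute[of 0])
  have cm: "continuous_on UNIV (m n)" for n
    unfolding m_def by (intro continuous_intros)
  define F' where "F' n i x h = (\<phi>' n x h * \<beta> n x + \<phi> n x * (\<beta>' n x * s' x h)) * (u x \<bullet> i)
      + \<phi> n x * \<beta> n x * (u' x h \<bullet> i)" for n i x h
  have F: "((\<lambda>x. \<phi> n x * \<beta> n x * (u x \<bullet> i)) has_derivative F' n i x) (at x)" for n i x
    unfolding F'_def by (rule derivative_eq_intros \<phi> \<beta> u refl)+ (simp add: algebra_simps)
  have cF: "continuous_on UNIV (\<lambda>x. F' n i x i)" for n i
    unfolding F'_def \<phi>_def \<phi>'_def
    by (intro continuous_intros c\<beta> c\<beta>' cm cu cont_s' cont_u')
  have F0: "\<phi> n x * \<beta> n x * (u x \<bullet> i) = 0" if "norm x > r n" for n i x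
    using m0[OF that] by (simp add: \<phi>_def)
  note intF = integral_derivative_compact_support_eq_0[OF F cF F0]
  have TF: "T n x = (\<Sum>i\<in>Basis. F' n i x i)" for n x
  proof -
    have rep: "(\<Sum>i\<in>Basis. L i * (u x \<bullet> i)) = L (u x)" if "linear L" for L :: "'a \<Rightarrow> real"
    proof -
      have "L (u x) = L (\<Sum>i\<in>Basis. (u x \<bullet> i) *\<^sub>R i)"
        by (simp add: euclidean_representation)
      also have "\<dots> = (\<Sum>i\<in>Basis. L i * (u x \<bullet> i))"
        using that by (simp add: linear_sum linear_scale mult.commute)
      finally show ?thesis by simp
    qed
    have "(\<Sum>i\<in>Basis. F' n i x i)
        = \<beta> n x * (\<Sum>i\<in>Basis. \<phi>' n x i * (u x \<bullet> i)) + \<phi> n x * \<beta>' n x * (\<Sum>i\<in>Basis. s' x i * (u x \<bullet> i))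
          + \<phi> n x * \<beta> n x * (\<Sum>i\<in>Basis. u' x i \<bullet> i)"
      unfolding F'_def sum_distrib_left sum.distrib[symmetric]
      by (intro sum.cong) (auto simp: algebra_simps)
    also have "\<dots> = T n x"
      unfolding rep[OF has_derivative_linear[OF \<phi>]] rep[OF has_derivative_linear[OF s]] div T_def
      by (simp add: algebra_simps)
    finally show ?thesis by simp
  qed
  have intT: "(\<integral>x. T n x \<partial>lborel) = 0" for n
    unfolding TF by (subst Bochner_Integration.integral_sum) (use intF in auto)
  have [measurable]: "T n \<in> borel_measurable borel" for n
    unfolding TF using cF by (intro borel_measurable_sum borel_measurable_continuous_onI)
  have \<beta>_bound: "0 \<le> \<beta> n x" "\<beta> n x \<le> s x powr \<theta>" for n x
    unfolding \<beta>_def using nonneg[of x] \<delta>[of n] \<open>0 < \<theta>\<close> \<open>\<theta> \<le> 1\<close>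
    by (auto intro!: powr_mono2 powr_add_diff_le)
  \<comment> \<open>Because \<open>\<theta> - 1 \<le> 0\<close>, dropping \<open>\<delta> n\<close>
    from the base can only increase the power, and \<open>transport\<close> supplies the factor
    \<open>s x\<close> that restores the exponent \<open>\<theta>\<close>. Where \<open>s\<close>
    vanishes, \<open>transport\<close> forces \<open>s' x (u x) = 0\<close>.\<close>
  have \<beta>'_bound: "\<beta>' n x * \<bar>s' x (u x)\<bar> \<le> C * \<theta> * s x powr \<theta>" for n x
  proof (cases "s x = 0")
    case True
    then show ?thesis using transport[of x] by simp
  next
    case False
    then have "s x > 0" using nonneg[of x] by simp
    have "\<beta>' n x * \<bar>s' x (u x)\<bar> \<le> (\<theta> * s x powr (\<theta> - 1)) * (C * s x)"
      unfolding \<beta>'_def using \<open>0 < \<theta>\<close> \<open>\<theta> \<le> 1\<close> \<open>s x > 0\<close> \<delta>[of n]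
      by (intro mult_mono transport mult_left_mono powr_mono2') auto
    also have "\<dots> = C * \<theta> * s x powr \<theta>"
      using \<open>s x > 0\<close> powr_add[of "s x" 1 "\<theta> - 1"] by simp
    finally show ?thesis .
  qed
  \<comment> \<open>On the support of the cutoff its gradient is of order \<open>1 / r n\<close>
    while \<open>norm (u x)\<close> is at most \<open>2 * K * r n\<close>; the product stays bounded
    independently of \<open>n\<close>.\<close>
  have \<phi>'_bound: "\<bar>\<phi>' n x (u x)\<bar> \<le> 8 * K" for n x
  proof (cases "norm x \<le> r n")
    case True
    have "\<bar>x \<bullet> u x\<bar> \<le> norm x * norm (u x)"
      by (rule Cauchy_Schwarz_ineq2)
    also have "\<dots> \<le> r n * (K * (2 * r n))"
    proof (rule mult_mono[OF True order_trans[OF growth]])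
      show "K * (1 + norm x) \<le> K * (2 * r n)"
        using True r[of n] \<open>0 \<le> K\<close> by (intro mult_left_mono) auto
    qed (use r[of n] in auto)
    finally have "\<bar>x \<bullet> u x\<bar> * (\<delta> n)\<^sup>2 \<le> r n * (K * (2 * r n)) * (\<delta> n)\<^sup>2"
      by (intro mult_right_mono) auto
    also have "\<dots> = 2 * K"
      using r[of n] by (simp add: \<delta>_def power2_eq_square)
    finally have "m n x * (\<bar>x \<bullet> u x\<bar> * (\<delta> n)\<^sup>2) \<le> 1 * (2 * K)"
      using m01[of n x] by (intro mult_mono[of _ 1]) auto
    then show ?thesis
      using m01[of n x] by (simp add: \<phi>'_def abs_mult)
  next
    case False
    then show ?thesis using \<open>0 \<le> K\<close> by (simp add: \<phi>'_def m0)
  qed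
  have \<phi>_bound: "0 \<le> \<phi> n x" "\<phi> n x \<le> 1" for n x
    using m01[of n x] by (auto simp: \<phi>_def power_le_one)
  have T_bound: "norm (T n x) \<le> (8 * K + C * \<theta> + \<bar>c\<bar>) * s x powr \<theta>" for n x
  proof -
    have "\<bar>\<phi>' n x (u x) * \<beta> n x\<bar> \<le> 8 * K * s x powr \<theta>"
      unfolding abs_mult using \<beta>_bound[of n x] \<open>0 \<le> K\<close> by (intro mult_mono \<phi>'_bound) auto
    moreover have "\<bar>\<phi> n x * \<beta>' n x * s' x (u x)\<bar> \<le> 1 * (C * \<theta> * s x powr \<theta>)"
    proof -
      have "0 \<le> \<beta>' n x"
        using \<open>0 < \<theta>\<close> by (simp add: \<beta>'_def)
      then have "\<bar>\<phi> n x * \<beta>' n x * s' x (u x)\<bar> = \<phi> n x * (\<beta>' n x * \<bar>s' x (u x)\<bar>)"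
        using \<phi>_bound[of n x] by (simp add: abs_mult)
      also have "\<dots> \<le> 1 * (C * \<theta> * s x powr \<theta>)"
        using \<phi>_bound[of n x] \<open>0 \<le> \<beta>' n x\<close> by (intro mult_mono \<beta>'_bound) auto
      finally show ?thesis .
    qed
    moreover have "\<bar>c * \<phi> n x * \<beta> n x\<bar> \<le> \<bar>c\<bar> * 1 * s x powr \<theta>"
      unfolding abs_mult using \<beta>_bound[of n x] \<phi>_bound[of n x] by (intro mult_mono) auto
    ultimately show ?thesis
      unfolding T_def real_norm_def distrib_right by linarith
  qed
  \<comment> \<open>Formally \<open>L\<close> is the divergence of \<open>s x powr \<theta>\<close>
    times \<open>u x\<close>. At zeros of \<open>s\<close> both terms are 0, by the convention that
    0 to any power under \<open>powr\<close> is 0.\<close>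
  define L where "L x = \<theta> * s x powr (\<theta> - 1) * s' x (u x) + c * s x powr \<theta>" for x
  have lim: "(\<lambda>n. T n x) \<longlonglongrightarrow> L x" for x
  proof -
    have "(\<lambda>n. m n x) \<longlonglongrightarrow> max 0 (1 - x \<bullet> x * 0\<^sup>2)"
      unfolding m_def by (intro tendsto_intros \<delta>0)
    then have mlim: "(\<lambda>n. m n x) \<longlonglongrightarrow> 1"
      by simp
    have 1: "(\<lambda>n. \<phi>' n x (u x)) \<longlonglongrightarrow> - 4 * 1 * (x \<bullet> u x) * 0\<^sup>2"
      unfolding \<phi>'_def by (intro tendsto_intros \<delta>0 mlim)
    have 2: "(\<lambda>n. \<phi> n x) \<longlonglongrightarrow> 1\<^sup>2"
      unfolding \<phi>_def by (intro tendsto_intros mlim)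
    have 3: "(\<lambda>n. \<beta> n x) \<longlonglongrightarrow> (s x + 0) powr \<theta> - 0 powr \<theta>"
      unfolding \<beta>_def using \<open>0 < \<theta>\<close> s\<delta>[of x] \<delta>
      by (intro tendsto_diff tendsto_powr2 tendsto_add tendsto_const \<delta>0)
         (auto intro!: always_eventually less_imp_le)
    have 4: "(\<lambda>n. \<beta>' n x * s' x (u x)) \<longlonglongrightarrow> \<theta> * s x powr (\<theta> - 1) * s' x (u x)"
    proof (cases "s x = 0")
      case True
      then show ?thesis using transport[of x] by simp
    next
      case False
      then have "(\<lambda>n. \<beta>' n x * s' x (u x)) \<longlonglongrightarrow> \<theta> * (s x + 0) powr (\<theta> - 1) * s' x (u x)"
        unfolding \<beta>'_def by (intro tendsto_intros \<delta>0) auto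
      then show ?thesis by simp
    qed
    have "(\<lambda>n. \<phi>' n x (u x) * \<beta> n x + \<phi> n x * (\<beta>' n x * s' x (u x)) + c * \<phi> n x * \<beta> n x) \<longlonglongrightarrow>
        (- 4 * 1 * (x \<bullet> u x) * 0\<^sup>2) * ((s x + 0) powr \<theta> - 0 powr \<theta>)
        + 1\<^sup>2 * (\<theta> * s x powr (\<theta> - 1) * s' x (u x)) + c * 1\<^sup>2 * ((s x + 0) powr \<theta> - 0 powr \<theta>)"
      by (intro tendsto_add tendsto_mult tendsto_const 1 2 3 4)
    then show ?thesis
      by (simp add: T_def L_def mult.assoc)
  qed
  have [measurable]: "L \<in> borel_measurable borel"
    unfolding L_def by measurable
  have idom: "integrable lborel (\<lambda>x. (8 * K + C * \<theta> + \<bar>c\<bar>) * s x powr \<theta>)"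
    using int' by simp
  have "(\<lambda>n. (\<integral>x. T n x \<partial>lborel)) \<longlonglongrightarrow> (\<integral>x. L x \<partial>lborel)"
    by (rule integral_dominated_convergence[OF _ _ idom AE_I2[OF lim] AE_I2[OF T_bound]]) measurable
  then have L0: "(\<integral>x. L x \<partial>lborel) = 0"
    unfolding intT by (simp add: LIMSEQ_const_iff)
  have iL: "integrable lborel L"
    by (rule integrable_dominated_convergence[OF _ _ idom AE_I2[OF lim] AE_I2[OF T_bound]]) measurable
  \<comment> \<open>The factor \<open>sgn c\<close> treats both signs of \<open>c\<close> at once.
    As \<open>L\<close> has integral zero, integrating this bound leaves a positive multiple of the
    integral of \<open>s x powr \<theta>\<close> below zero.\<close>
  have L_ge: "(\<bar>c\<bar> - C * \<theta>) * s x powr \<theta> \<le> sgn c * L x" for x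
  proof -
    have "\<bar>\<theta> * s x powr (\<theta> - 1) * s' x (u x)\<bar> \<le> C * \<theta> * s x powr \<theta>"
    proof (cases "s x = 0")
      case True
      then show ?thesis using transport[of x] by simp
    next
      case False
      then have "s x > 0" using nonneg[of x] by simp
      have "\<bar>\<theta> * s x powr (\<theta> - 1) * s' x (u x)\<bar> \<le> (\<theta> * s x powr (\<theta> - 1)) * (C * s x)"
        unfolding abs_mult using \<open>0 < \<theta>\<close> by (intro mult_mono transport) auto
      also have "\<dots> = C * \<theta> * s x powr \<theta>"
        using \<open>s x > 0\<close> powr_add[of "s x" 1 "\<theta> - 1"] by simp
      finally show ?thesis .
    qed
    then have "\<bar>sgn c * (\<theta> * s x powr (\<theta> - 1) * s' x (u x))\<bar> \<le> C * \<theta> * s x powr \<theta>"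
      using \<open>C * \<theta> < \<bar>c\<bar>\<close> \<open>0 \<le> C\<close> \<open>0 < \<theta>\<close> by (auto simp: abs_mult sgn_if)
    moreover have "sgn c * (c * s x powr \<theta>) = \<bar>c\<bar> * s x powr \<theta>"
      by (auto simp: sgn_if)
    ultimately show ?thesis
      unfolding L_def distrib_left left_diff_distrib by linarith
  qed
  have "(\<integral>x. (\<bar>c\<bar> - C * \<theta>) * s x powr \<theta> \<partial>lborel) \<le> (\<integral>x. sgn c * L x \<partial>lborel)"
    by (intro integral_mono L_ge) (use int' iL in auto)
  also have "\<dots> = 0"
    using L0 by simp
  finally have "(\<integral>x. s x powr \<theta> \<partial>lborel) \<le> 0"
    using \<open>C * \<theta> < \<bar>c\<bar>\<close> by (simp add: mult_le_0_iff)
  moreover have "(\<integral>x. s x powr \<theta> \<partial>lborel) \<ge> 0"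
    by (intro integral_nonneg_AE) auto
  ultimately have "AE x in lborel. s x powr \<theta> = 0"
    using integral_nonneg_eq_0_iff_AE[OF int'] by auto
  then have "AE x in lebesgue. x \<notin> {x. s x \<noteq> 0}"
    by (intro AE_completion) auto
  moreover have "open {x. s x \<noteq> 0}"
    by (intro open_Collect_neq cs continuous_intros)
  ultimately show ?thesis
    using AE_lebesgue_open_empty by blast
qed

section \<open>Coordinate calculus for fields of class C^2\<close>

lemma sum_Basis_vec:
  fixes f :: "real ^ 'n \<Rightarrow> 'b::comm_monoid_add"
  shows "(\<Sum>i\<in>Basis. f i) = (\<Sum>k\<in>UNIV. f (axis k 1))"
proof -
  have Basis: "(Basis :: (real ^ 'n) set) = range (\<lambda>k. axis k 1)"
    by (auto simp: Basis_vec_def)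
  have inj: "inj (\<lambda>k. axis k 1 :: real ^ 'n)"
    by (auto intro!: injI simp: axis_eq_axis)
  show ?thesis
    unfolding Basis using sum.reindex[OF inj, of f] by (simp add: o_def)
qed

lemma Ck_2D:
  assumes "Ck 2 f"
  shows "f differentiable (at x)" "partial_deriv i f differentiable (at x)"
    "continuous_on UNIV (partial_deriv j (partial_deriv i f))"
    "partial_deriv i (partial_deriv j f) x = partial_deriv j (partial_deriv i f) x"
proof -
  show *: "f differentiable (at x)" "partial_deriv i f differentiable (at x)"
    "continuous_on UNIV (partial_deriv j (partial_deriv i f))" for x i j
    using assms by (auto simp: numeral_2_eq_2 differentiable_on_def)
  show "partial_deriv i (partial_deriv j f) x = partial_deriv j (partial_deriv i f) x"
    by (rule partial_deriv_commute[OF *])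
qed

lemma partial_deriv_diff:
  assumes "f differentiable (at x)" "g differentiable (at x)"
  shows "partial_deriv i (\<lambda>x. f x - g x) x = partial_deriv i f x - partial_deriv i g x"
proof -
  have "((\<lambda>x. f x - g x) has_derivative (\<lambda>h. (\<Sum>i\<in>UNIV. h $ i * partial_deriv i f x)
      - (\<Sum>i\<in>UNIV. h $ i * partial_deriv i g x))) (at x)"
    by (intro has_derivative_diff has_derivative_partial_deriv assms)
  from partial_deriv_has_derivative[OF this] show ?thesis
    by (simp add: axis_def if_distrib if_distribR cong: if_cong)
qed

lemma partial_deriv_sum:
  assumes "\<And>k. k \<in> I \<Longrightarrow> f k differentiable (at x)"
  shows "partial_deriv i (\<lambda>x. \<Sum>k\<in>I. f k x) x = (\<Sum>k\<in>I. partial_deriv i (f k) x)"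
proof -
  have "((\<lambda>x. \<Sum>k\<in>I. f k x) has_derivative (\<lambda>h. \<Sum>k\<in>I. (\<Sum>i\<in>UNIV. h $ i * partial_deriv i (f k) x))) (at x)"
    by (intro has_derivative_sum has_derivative_partial_deriv assms)
  from partial_deriv_has_derivative[OF this] show ?thesis
    by (simp add: axis_def if_distrib if_distribR cong: if_cong)
qed

lemma partial_deriv_minus:
  assumes "f differentiable (at x)"
  shows "partial_deriv i (\<lambda>x. - f x) x = - partial_deriv i f x"
proof -
  have "((\<lambda>x. - f x) has_derivative (\<lambda>h. - (\<Sum>i\<in>UNIV. h $ i * partial_deriv i f x))) (at x)"
    by (intro has_derivative_minus has_derivative_partial_deriv assms)
  from partial_deriv_has_derivative[OF this] show ?thesis
    by (simp add: axis_def if_distrib if_distribR cong: if_cong)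
qed

lemma has_derivative_field:
  fixes v :: "real ^ 'n \<Rightarrow> real ^ 'm"
  assumes "\<And>i. (\<lambda>y. v y $ i) differentiable (at x)"
  shows "(v has_derivative (\<lambda>h. \<chi> i. \<Sum>j\<in>UNIV. h $ j * partial_deriv j (\<lambda>y. v y $ i) x)) (at x)"
proof (subst has_derivative_componentwise_within, intro ballI)
  fix e :: "real ^ 'm" assume "e \<in> Basis"
  then obtain i where e: "e = axis i 1"
    by (auto simp: Basis_vec_def)
  show "((\<lambda>x. v x \<bullet> e) has_derivative
      (\<lambda>h. (\<chi> i. \<Sum>j\<in>UNIV. h $ j * partial_deriv j (\<lambda>y. v y $ i) x) \<bullet> e)) (at x)"
    using has_derivative_partial_deriv[OF assms[of i]] by (simp add: e inner_axis)
qed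

section \<open>The vorticity equation\<close>

text \<open>The system expresses each \<open>partial_deriv i p\<close> through \<open>v\<close> and
  its first derivatives. Hence the second partial derivatives of \<open>p\<close> exist and are
  continuous, and their symmetry is exactly the curl of the system, with \<open>p\<close>
  eliminated.\<close>

lemma vorticity_equation:
  fixes v :: "real ^ 'n \<Rightarrow> real ^ 'n" and p :: "real ^ 'n \<Rightarrow> real"
  defines "A \<equiv> \<lambda>k i. partial_deriv k (\<lambda>y. v y $ i)"
  defines "W \<equiv> \<lambda>k i x. A k i x - A i k x"
  assumes v: "Ck_field 2 v"
    and p: "p differentiable_on UNIV"
    and eq: "\<And>x. advect v v x = - grad p x + a *\<^sub>R v x + b *\<^sub>R advect (\<lambda>y. y) v x"
  shows "(\<Sum>j\<in>UNIV. (v x $ j - b * x $ j) * partial_deriv j (W k i) x)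
    = (a + b) * W k i x - (\<Sum>j\<in>UNIV. A k j x * W j i x + W k j x * A i j x)"
proof -
  have C2: "Ck 2 (\<lambda>y. v y $ i)" for i
    using v by (simp add: Ck_field_def)
  note v1 = Ck_2D(1)[OF C2]
  have v2: "A k i differentiable (at x)"
    and cont_A': "continuous_on UNIV (partial_deriv j (A k i))" for j k i x
    unfolding A_def by (rule Ck_2D(2,3)[OF C2])+
  have sym: "partial_deriv j (A k i) x = partial_deriv k (A j i) x" for j k i x
    unfolding A_def by (rule Ck_2D(4)[OF C2])
  have cont_v: "continuous_on UNIV (\<lambda>y. v y $ i)" for i
    using v1 by (intro differentiable_imp_continuous_on) (simp add: differentiable_on_def)
  have cont_A: "continuous_on UNIV (A k i)" for k i
    using v2 by (intro differentiable_imp_continuous_on) (simp add: differentiable_on_def)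
  \<comment> \<open>\<open>G i\<close> is the system solved for the \<open>i\<close>-th partial
    derivative of \<open>p\<close>; \<open>G' k i\<close> is the derivative of \<open>G i\<close> in
    direction \<open>k\<close>.\<close>
  define G where "G i x = a * v x $ i - (\<Sum>j\<in>UNIV. (v x $ j - b * x $ j) * A j i x)" for i x
  define G' where "G' k i x = a * A k i x - (\<Sum>j\<in>UNIV. (A k j x - b * axis k 1 $ j) * A j i x
      + (v x $ j - b * x $ j) * partial_deriv k (A j i) x)" for k i x
  have grad_p: "partial_deriv i p = G i" for i
  proof
    fix x
    show "partial_deriv i p x = G i x"
      using arg_cong[OF eq[of x], of "\<lambda>y. y $ i"]
      by (simp add: advect_def grad_def G_def A_def left_diff_distrib sum_subtractf
          sum_distrib_left algebra_simps)
  qed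
  have dv: "((\<lambda>y. v y $ i) has_derivative (\<lambda>h. \<Sum>k\<in>UNIV. h $ k * A k i x)) (at x)" for i x
    unfolding A_def by (rule has_derivative_partial_deriv[OF v1])
  note dA = has_derivative_partial_deriv[OF v2]
  have dG: "(G i has_derivative (\<lambda>h. a * (\<Sum>k\<in>UNIV. h $ k * A k i x)
      - (\<Sum>j\<in>UNIV. (v x $ j - b * x $ j) * (\<Sum>k\<in>UNIV. h $ k * partial_deriv k (A j i) x)
        + ((\<Sum>k\<in>UNIV. h $ k * A k j x) - b * h $ j) * A j i x))) (at x)" for i x
    unfolding G_def
    by (intro has_derivative_diff has_derivative_sum has_derivative_mult has_derivative_mult_right
        dv dA bounded_linear.has_derivative[OF bounded_linear_vec_nth] has_derivative_ident)
  have pG: "partial_deriv k (G i) = G' k i" for k i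
  proof
    fix x
    show "partial_deriv k (G i) x = G' k i x"
      unfolding partial_deriv_has_derivative[OF dG]
      by (simp add: G'_def axis_def if_distrib if_distribR add.commute cong: if_cong)
  qed
  \<comment> \<open>The regularity of \<open>p\<close> demanded by
    \<open>partial_deriv_commute\<close> is read off from \<open>grad_p\<close> and
    \<open>pG\<close>.\<close>
  have "G' k i x = G' i k x"
    unfolding pG[symmetric] grad_p[symmetric]
  proof (rule partial_deriv_commute)
    show "p differentiable (at x)" for x
      using p by (simp add: differentiable_on_def)
    show "partial_deriv i p differentiable (at x)" for i x
      unfolding grad_p using dG by (auto simp: differentiable_def)
    show "continuous_on UNIV (partial_deriv j (partial_deriv i p))" for i j
      unfolding grad_p pG G'_def by (intro continuous_intros cont_v cont_A cont_A')
  qed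
  then have *: "a * W k i x = (\<Sum>j\<in>UNIV. (A k j x - b * axis k 1 $ j) * A j i x
      + (v x $ j - b * x $ j) * partial_deriv k (A j i) x) -
      (\<Sum>j\<in>UNIV. (A i j x - b * axis i 1 $ j) * A j k x
      + (v x $ j - b * x $ j) * partial_deriv i (A j k) x)"
    by (simp add: G'_def W_def algebra_simps)
  have ax: "(\<Sum>j\<in>UNIV. b * axis k 1 $ j * A j i x) = b * A k i x" for k i
    by (simp add: axis_def if_distrib if_distribR cong: if_cong)
  have W': "partial_deriv j (W k i) x = partial_deriv k (A j i) x - partial_deriv i (A j k) x" for j
    unfolding W_def by (subst partial_deriv_diff) (auto intro: v2 simp: sym[of j])
  \<comment> \<open>On the right side the products \<open>A k j x * A i j x\<close> cancel. What
    remains is the antisymmetrised quadratic term of \<open>*\<close>, which is how that term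
    becomes linear in \<open>W\<close>.\<close>
  show ?thesis
    unfolding W' using * ax[of k i] ax[of i k] unfolding W_def
    by (simp add: sum.distrib sum_subtractf algebra_simps)
qed

section \<open>Potentials of curl-free fields\<close>

text \<open>Poincare's lemma: the potential at \<open>x\<close> is the integral of
  \<open>v (t x)\<close> against \<open>x\<close> over \<open>t\<close> in [0, 1]. Under the
  integral sign, symmetry of \<open>D\<close> turns its derivative in direction \<open>k\<close>
  into the inner product of \<open>k\<close> with \<open>g x t\<close>. Since \<open>g x t\<close>
  is the \<open>t\<close>-derivative of \<open>t\<close> times \<open>v (t x)\<close>, it integrates
  to \<open>v x\<close>.\<close>

lemma symmetric_derivative_imp_gradient:
  fixes v :: "'a::euclidean_space \<Rightarrow> 'a"
  assumes v: "\<And>x. (v has_derivative D x) (at x)"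
    and cont: "continuous_on UNIV (\<lambda>(x, h). D x h)"
    and sym: "\<And>x h k. D x h \<bullet> k = D x k \<bullet> h"
  obtains f where "\<And>x. (f has_derivative (\<lambda>k. v x \<bullet> k)) (at x)"
proof
  define g where "g x t = v (t *\<^sub>R x) + t *\<^sub>R D (t *\<^sub>R x) x" for x and t :: real
  have cv: "continuous_on UNIV v"
    using v by (meson continuous_at_imp_continuous_on has_derivative_continuous)
  have D_scale: "D x (t *\<^sub>R h) = t *\<^sub>R D x h" for x h t
    using linear_scale[OF has_derivative_linear[OF v]] .
  have dv: "((\<lambda>y. v (t *\<^sub>R y)) has_derivative (\<lambda>k. t *\<^sub>R D (t *\<^sub>R x) k)) (at x)" for t x
  proof -
    have "((\<lambda>y. v (t *\<^sub>R y)) has_derivative (\<lambda>k. D (t *\<^sub>R x) (t *\<^sub>R k))) (at x)"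
      by (rule has_derivative_compose[where f = "\<lambda>y. t *\<^sub>R y" and g = v])
         (auto intro!: derivative_eq_intros v)
    then show ?thesis by (simp add: D_scale)
  qed
  fix x
  have cg: "continuous_on (UNIV \<times> cbox 0 1) (\<lambda>(x, t). g x t)"
    unfolding g_def split_beta
    by (intro continuous_intros continuous_on_compose2[OF cv]
        continuous_on_compose2[OF cont[unfolded split_beta], of _ "\<lambda>p. (snd p *\<^sub>R fst p, fst p)", simplified]) auto
  have "((\<lambda>x. integral (cbox 0 1) (\<lambda>t. v (t *\<^sub>R x) \<bullet> x)) has_derivative
      blinfun_apply (integral (cbox 0 1) (\<lambda>t. blinfun_inner_left (g x t)))) (at x within UNIV)"
  proof (rule leibniz_rule)
    fix x t
    have "((\<lambda>y. v (t *\<^sub>R y) \<bullet> y) has_derivative (\<lambda>k. v (t *\<^sub>R x) \<bullet> k + t *\<^sub>R D (t *\<^sub>R x) k \<bullet> x)) (at x)"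
      by (intro has_derivative_inner dv has_derivative_ident)
    moreover have "v (t *\<^sub>R x) \<bullet> k + t *\<^sub>R D (t *\<^sub>R x) k \<bullet> x = k \<bullet> g x t" for k
      by (simp add: g_def inner_right_distrib inner_commute[of k] sym[of _ k])
    ultimately show "((\<lambda>y. v (t *\<^sub>R y) \<bullet> y) has_derivative blinfun_inner_left (g x t)) (at x)"
      by simp
  next
    show "(\<lambda>t. v (t *\<^sub>R x) \<bullet> x) integrable_on cbox 0 1" for x
      by (intro integrable_continuous continuous_intros continuous_on_compose2[OF cv]) auto
    show "continuous_on (UNIV \<times> cbox 0 1) (\<lambda>(x, t). blinfun_inner_left (g x t))"
      using bounded_linear.continuous_on[OF bounded_linear_blinfun_inner_left cg]
      by (simp add: split_beta)
  qed auto
  moreover have "integral (cbox 0 1) (\<lambda>t. blinfun_inner_left (g x t))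
      = blinfun_inner_left (integral (cbox 0 1) (g x))"
  proof -
    have "continuous_on (cbox 0 1) (\<lambda>t. (x, t))"
      by (intro continuous_intros)
    from continuous_on_compose2[OF cg this] have "continuous_on (cbox 0 1) (g x)"
      by auto
    from integral_linear[OF integrable_continuous[OF this] bounded_linear_blinfun_inner_left]
    show ?thesis by (simp add: o_def)
  qed
  moreover have "integral (cbox 0 1) (g x) = v x"
  proof -
    have "((\<lambda>t. t *\<^sub>R v (t *\<^sub>R x)) has_vector_derivative g x t) (at t within {0..1})" for t
    proof -
      have "((\<lambda>t. v (t *\<^sub>R x)) has_derivative (\<lambda>s. D (t *\<^sub>R x) (s *\<^sub>R x))) (at t)"
        by (rule has_derivative_compose[where f = "\<lambda>t. t *\<^sub>R x" and g = v])
           (auto intro!: derivative_eq_intros v)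
      then have "((\<lambda>t. v (t *\<^sub>R x)) has_vector_derivative D (t *\<^sub>R x) x) (at t)"
        by (simp add: has_vector_derivative_def D_scale)
      then have "((\<lambda>t. t *\<^sub>R v (t *\<^sub>R x)) has_vector_derivative g x t) (at t)"
        unfolding g_def by (auto intro!: derivative_eq_intros)
      then show ?thesis
        by (rule has_vector_derivative_at_within)
    qed
    from fundamental_theorem_of_calculus[OF _ this] show ?thesis
      by (simp add: integral_unique)
  qed
  ultimately show "((\<lambda>x. integral (cbox 0 1) (\<lambda>t. v (t *\<^sub>R x) \<bullet> x)) has_derivative (\<lambda>k. v x \<bullet> k)) (at x)"
    by (simp add: inner_commute)
qed

section \<open>The maximum principle for functions decaying at infinity\<close>

text \<open>If \<open>f x > 0\<close>, adding a small multiple of the squared norm gives a strictly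
  subharmonic \<open>g\<close> that still attains its maximum over a large ball in the interior.
  Some pure second derivative of \<open>g\<close> is positive there, contradicting
  maximality.\<close>

lemma subharmonic_decay_nonpos:
  fixes f :: "real ^ 'n \<Rightarrow> real"
  assumes C2: "Ck 2 f" and lap: "\<And>x. 0 \<le> laplacian f x" and lim: "(f \<longlongrightarrow> 0) at_infinity"
  shows "f x \<le> 0"
proof (rule ccontr)
  assume "\<not> f x \<le> 0"
  then have fx: "f x > 0" by simp
  have "eventually (\<lambda>y. \<bar>f y\<bar> < f x / 2) at_infinity"
    using tendstoD[OF lim, of "f x / 2"] fx by (simp add: dist_real_def)
  then obtain R0 where R0: "\<And>y. R0 \<le> norm y \<Longrightarrow> \<bar>f y\<bar> < f x / 2"
    by (auto simp: eventually_at_infinity)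
  define R where "R = max R0 (norm x + 1)"
  have R: "norm x < R" "R > 0"
    using norm_ge_zero[of x] unfolding R_def by linarith+
  \<comment> \<open>The perturbation is \<open>f x / 4\<close> on the sphere of radius
    \<open>R\<close>, where \<open>f\<close> is below \<open>f x / 2\<close>. So \<open>g\<close>
    stays below \<open>f x \<le> g x\<close> on that sphere.\<close>
  define e where "e = f x / (4 * R\<^sup>2)"
  have e: "e > 0" using fx R by (simp add: e_def)
  define g where "g y = f y + e * (y \<bullet> y)" for y
  have "continuous_on (cball 0 R) f"
    using Ck_2D(1)[OF C2] by (meson continuous_at_imp_continuous_on differentiable_imp_continuous_within)
  then have "continuous_on (cball 0 R) g"
    unfolding g_def by (intro continuous_intros)
  then obtain z where z: "norm z \<le> R" "\<And>y. norm y \<le> R \<Longrightarrow> g y \<le> g z"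
    using continuous_attains_sup[of "cball 0 R" g] R(2) by fastforce
  have "norm z < R"
  proof (rule ccontr)
    assume "\<not> norm z < R"
    then have nz: "norm z = R" using z by simp
    then have "f z < f x / 2"
      using R0[of z] by (auto simp: R_def)
    moreover have "e * (z \<bullet> z) = f x / 4"
      using nz R by (simp add: e_def flip: power2_norm_eq_inner)
    moreover have "f x \<le> g x" using e by (simp add: g_def)
    ultimately show False
      using z(2)[of x] R fx by (simp add: g_def)
  qed
  \<comment> \<open>The summands are the pure second derivatives of \<open>g\<close> at
    \<open>z\<close>; a positive sum forces one of them to be positive.\<close>
  have "0 < (\<Sum>i\<in>UNIV. partial_deriv i (partial_deriv i f) z + 2 * e)"
    using lap[of z] e by (simp add: sum.distrib laplacian_def add_nonneg_pos)
  then have "\<not> (\<forall>i. partial_deriv i (partial_deriv i f) z + 2 * e \<le> 0)"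
    using sum_nonpos[of UNIV "\<lambda>i. partial_deriv i (partial_deriv i f) z + 2 * e"] by (auto simp: not_less[symmetric])
  then have "\<exists>i. 0 < partial_deriv i (partial_deriv i f) z + 2 * e"
    by (simp add: not_le)
  then obtain i where i: "0 < partial_deriv i (partial_deriv i f) z + 2 * e" ..
  define q where "q t = g (z + t *\<^sub>R axis i 1)" for t
  define q' where "q' t = partial_deriv i f (z + t *\<^sub>R axis i 1) + e * (2 * z $ i + 2 * t)" for t
  have expand: "(z + t *\<^sub>R axis i 1) \<bullet> (z + t *\<^sub>R axis i 1) = z \<bullet> z + 2 * t * z $ i + t * t" for t
    by (simp add: inner_add_left inner_add_right inner_axis inner_axis' algebra_simps)
  have q: "(q has_real_derivative q' t) (at t)" for t
    unfolding q_def g_def expand q'_def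
    by (auto intro!: derivative_eq_intros DERIV_along_axis Ck_2D(1)[OF C2] simp: algebra_simps)
  have q': "(q' has_real_derivative partial_deriv i (partial_deriv i f) z + 2 * e) (at 0)"
    unfolding q'_def
    using DERIV_along_axis[OF Ck_2D(2)[OF C2], of i z i 0]
    by (auto intro!: derivative_eq_intros)
  define d where "d = R - norm z"
  have d: "d > 0" using \<open>norm z < R\<close> by (simp add: d_def)
  have max: "q t \<le> q 0" if "\<bar>t\<bar> < d" for t
  proof -
    have "norm (z + t *\<^sub>R axis i 1) \<le> norm z + \<bar>t\<bar>"
      using norm_triangle_ineq[of z "t *\<^sub>R axis i 1"] by (simp add: norm_axis_1)
    then show ?thesis
      using that z(2) by (simp add: q_def d_def)
  qed
  \<comment> \<open>A critical point with positive second derivative: \<open>q'\<close> is positive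
    just to the right of 0, so \<open>q\<close> increases there, against \<open>max\<close>.\<close>
  have "q' 0 = 0"
    by (rule DERIV_local_max[OF q d]) (use max in auto)
  with DERIV_pos_inc_right[OF q' i] obtain d' where d': "d' > 0" "\<And>h. 0 < h \<Longrightarrow> h < d' \<Longrightarrow> 0 < q' h"
    by auto
  define t where "t = min d d' / 2"
  have t: "0 < t" "t < d" "t < d'"
    using d d' by (auto simp: t_def min_def)
  have "\<exists>s. 0 < s \<and> s < t \<and> q t - q 0 = (t - 0) * q' s"
    by (intro MVT2 t q)
  then obtain s where s: "0 < s" "s < t" "q t - q 0 = t * q' s"
    by auto
  then have "0 < q t - q 0"
    using d'(2)[of s] t by simp
  with max[of t] t show False by simp
qed

text \<open>Both \<open>f\<close> and its negative are subharmonic and decay, so both are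
  nonpositive.\<close>

lemma harmonic_decay_zero:
  assumes C2: "Ck 2 f" and lap: "\<And>x. laplacian f x = 0" and lim: "(f \<longlongrightarrow> 0) at_infinity"
  shows "f x = 0"
proof -
  have 1: "partial_deriv i (\<lambda>x. - f x) = (\<lambda>x. - partial_deriv i f x)" for i
    by (intro ext partial_deriv_minus Ck_2D(1)[OF C2])
  have 2: "partial_deriv j (\<lambda>x. - partial_deriv i f x) = (\<lambda>x. - partial_deriv j (partial_deriv i f) x)" for i j
    by (intro ext partial_deriv_minus Ck_2D(2)[OF C2])
  have "Ck 2 (\<lambda>x. - f x)"
    using C2 by (auto simp: numeral_2_eq_2 1 2 differentiable_on_def intro!: continuous_intros)
  moreover have "laplacian (\<lambda>x. - f x) x = 0" for x
    using lap[of x] by (simp add: laplacian_def 1 2 sum_negf)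
  moreover have "((\<lambda>x. - f x) \<longlongrightarrow> 0) at_infinity"
    using tendsto_minus[OF lim] by simp
  ultimately have "- f x \<le> 0"
    by (intro subharmonic_decay_nonpos) auto
  moreover have "f x \<le> 0"
    using subharmonic_decay_nonpos[OF C2 _ lim] lap by simp
  ultimately show ?thesis by simp
qed

section \<open>Vanishing of the vorticity\<close>

text \<open>The hypotheses of \<open>transport_powr_integrable_vanishes\<close> are verified for
  \<open>u\<close> and for the squared Frobenius norm \<open>s\<close> of \<open>W\<close>.
  Integrability for all small exponents makes room for one with
  \<open>C * \<theta> < \<bar>c\<bar>\<close>.\<close>

lemma self_similar_irrotational:
  fixes v :: "real ^ 'n \<Rightarrow> real ^ 'n" and p :: "real ^ 'n \<Rightarrow> real"
  defines "A \<equiv> \<lambda>k i. partial_deriv k (\<lambda>y. v y $ i)"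
  assumes "b \<noteq> 0" and v: "Ck_field 2 v" and p: "p differentiable_on UNIV"
    and eq: "\<And>x. advect v v x = - grad p x + a *\<^sub>R v x + b *\<^sub>R advect (\<lambda>y. y) v x"
    and div: "\<And>x. div_field v x = 0"
    and bound: "\<And>k i x. \<bar>A k i x\<bar> \<le> M"
    and "r > 0"
    and int: "\<And>\<theta>. 0 < \<theta> \<Longrightarrow> \<theta> < r \<Longrightarrow>
      integrable lebesgue (\<lambda>x. (\<Sum>k\<in>UNIV. \<Sum>i\<in>UNIV. (A k i x - A i k x)\<^sup>2) powr \<theta>)"
  shows "A k i x = A i k x"
proof -
  define W where "W k i x = A k i x - A i k x" for k i x
  define n where "n = real CARD('n)"
  have n: "n \<ge> 1" using one_le_card_finite[where 'a = 'n] by (simp add: n_def)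
  have M: "M \<ge> 0" using bound[of k i x] by linarith
  have C2: "Ck 2 (\<lambda>y. v y $ i)" for i
    using v by (simp add: Ck_field_def)
  note v1 = Ck_2D(1)[OF C2]
  have A1: "A k i differentiable (at x)"
    and cont_A': "continuous_on UNIV (partial_deriv j (A k i))" for j k i x
    unfolding A_def by (rule Ck_2D(2,3)[OF C2])+
  have cont_A: "continuous_on UNIV (A k i)" for k i
    using A1 by (intro differentiable_imp_continuous_on) (simp add: differentiable_on_def)
  have W1: "W k i differentiable (at x)" for k i x
    unfolding W_def by (intro differentiable_diff A1)
  have cont_W: "continuous_on UNIV (W k i)" for k i
    using W1 by (intro differentiable_imp_continuous_on) (simp add: differentiable_on_def)
  have cont_W': "continuous_on UNIV (partial_deriv j (W k i))" for j k i
  proof -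
    have "partial_deriv j (W k i) = (\<lambda>x. partial_deriv j (A k i) x - partial_deriv j (A i k) x)"
      unfolding W_def by (intro ext partial_deriv_diff A1)
    then show ?thesis by (auto intro!: continuous_intros cont_A')
  qed
  have vorticity: "(\<Sum>j\<in>UNIV. (v x - b *\<^sub>R x) $ j * partial_deriv j (W k i) x)
      = (a + b) * W k i x - (\<Sum>j\<in>UNIV. A k j x * W j i x + W k j x * A i j x)" for k i x
    using vorticity_equation[OF v p eq, of x k i] by (simp add: W_def[abs_def] A_def)
  define s where "s x = (\<Sum>k\<in>UNIV. \<Sum>i\<in>UNIV. (W k i x)\<^sup>2)" for x
  define s' where "s' x h = (\<Sum>k\<in>UNIV. \<Sum>i\<in>UNIV. 2 * W k i x *
      (\<Sum>j\<in>UNIV. h $ j * partial_deriv j (W k i) x))" for x h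
  define u where "u x = v x - b *\<^sub>R x" for x
  define u' where "u' x h = (\<chi> i. \<Sum>j\<in>UNIV. h $ j * A j i x) - b *\<^sub>R h" for x h
  define c where "c = - (b * n)"
  \<comment> \<open>The two outer factors \<open>n\<close> count the pairs \<open>(k, i)\<close>.
    The rest bounds \<open>2 * W k i x\<close> times the right side of the vorticity equation, whose
    sum has \<open>n\<close> terms of size at most \<open>2 * M * w\<close>, where \<open>w\<close>
    is the square root of \<open>s x\<close>.\<close>
  define C where "C = n * (n * (2 * (\<bar>a + b\<bar> + n * (2 * M))))"
  define B where "B = n * (n * M)"
  have C: "C \<ge> 0" using n M by (simp add: C_def)
  have c: "\<bar>c\<bar> > 0" using n \<open>b \<noteq> 0\<close> by (simp add: c_def)
  have ds: "(s has_derivative s' x) (at x)" for x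
  proof -
    have "((\<lambda>x. (W k i x)\<^sup>2) has_derivative
        (\<lambda>h. 2 * W k i x * (\<Sum>j\<in>UNIV. h $ j * partial_deriv j (W k i) x))) (at x)" for k i
      by (rule derivative_eq_intros has_derivative_partial_deriv[OF W1] refl)+ (simp add: fun_eq_iff)
    then show ?thesis
      unfolding s_def s'_def by (intro has_derivative_sum)
  qed
  have dv: "(v has_derivative (\<lambda>h. \<chi> i. \<Sum>j\<in>UNIV. h $ j * A j i x)) (at x)" for x
    unfolding A_def by (rule has_derivative_field[OF v1])
  have du: "(u has_derivative u' x) (at x)" for x
    unfolding u_def u'_def
    by (intro has_derivative_diff dv bounded_linear.has_derivative[OF bounded_linear_scaleR_right]
        has_derivative_ident)
  have div_u: "(\<Sum>i\<in>Basis. u' x i \<bullet> i) = c" for x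
  proof -
    have "u' x (axis i 1) $ i = A i i x - b" for i
      unfolding u'_def by (simp add: axis_def if_distrib if_distribR cong: if_cong)
    then have "(\<Sum>i\<in>Basis. u' x i \<bullet> i) = (\<Sum>i\<in>UNIV. A i i x - b)"
      unfolding sum_Basis_vec by (simp add: inner_axis)
    also have "\<dots> = c"
      using div[of x] by (simp add: div_field_def A_def sum_subtractf c_def n_def)
    finally show ?thesis .
  qed
  have transport: "\<bar>s' x (u x)\<bar> \<le> C * s x" for x
  proof -
    define w where "w = sqrt (s x)"
    have "s x \<ge> 0" by (simp add: s_def sum_nonneg)
    then have w: "w \<ge> 0" "w * w = s x" by (simp_all add: w_def)
    have W_le: "\<bar>W k i x\<bar> \<le> w" for k i
    proof -
      have "(W k i x)\<^sup>2 \<le> (\<Sum>i\<in>UNIV. (W k i x)\<^sup>2)"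
        by (rule member_le_sum) auto
      also have "\<dots> \<le> s x"
        unfolding s_def by (rule member_le_sum) (auto intro: sum_nonneg)
      finally show ?thesis
        unfolding w_def by (intro real_le_rsqrt) simp
    qed
    have "\<bar>A k j x * W j i x + W k j x * A i j x\<bar> \<le> 2 * M * w" for k i j
    proof -
      have "\<bar>A k j x * W j i x\<bar> \<le> M * w" "\<bar>W k j x * A i j x\<bar> \<le> w * M"
        unfolding abs_mult by (intro mult_mono bound W_le M w abs_ge_zero)+
      from order_trans[OF abs_triangle_ineq add_mono[OF this]] show ?thesis
        by (simp add: mult.commute mult.left_commute)
    qed
    then have "\<bar>\<Sum>j\<in>UNIV. A k j x * W j i x + W k j x * A i j x\<bar> \<le> n * (2 * M * w)" for k i
      unfolding n_def by (intro order_trans[OF sum_abs] sum_bounded_above)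
    moreover have "\<bar>(a + b) * W k i x\<bar> \<le> \<bar>a + b\<bar> * w" for k i
      unfolding abs_mult by (intro mult_left_mono W_le) auto
    ultimately have "\<bar>(a + b) * W k i x - (\<Sum>j\<in>UNIV. A k j x * W j i x + W k j x * A i j x)\<bar>
        \<le> \<bar>a + b\<bar> * w + n * (2 * M * w)" for k i
      by (intro order_trans[OF abs_triangle_ineq4] add_mono)
    then have "\<bar>2 * W k i x * ((a + b) * W k i x - (\<Sum>j\<in>UNIV. A k j x * W j i x + W k j x * A i j x))\<bar>
        \<le> (2 * w) * (\<bar>a + b\<bar> * w + n * (2 * M * w))" for k i
      using w W_le[of k i] by (subst abs_mult, intro mult_mono) auto
    then have "\<bar>s' x (u x)\<bar> \<le> n * (n * ((2 * w) * (\<bar>a + b\<bar> * w + n * (2 * M * w))))"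
      unfolding s'_def u_def vorticity n_def
      by (intro order_trans[OF sum_abs] sum_bounded_above)
    also have "\<dots> = C * (w * w)"
      by (simp add: C_def algebra_simps)
    finally show ?thesis unfolding w .
  qed
  have growth: "norm (u x) \<le> (norm (v 0) + B + \<bar>b\<bar>) * (1 + norm x)" for x
  proof -
    have "norm (\<chi> i. \<Sum>j\<in>UNIV. h $ j * A j i y) \<le> B * norm h" for y h
    proof -
      have "\<bar>\<Sum>j\<in>UNIV. h $ j * A j i y\<bar> \<le> n * (norm h * M)" for i
        unfolding n_def
        by (intro order_trans[OF sum_abs] sum_bounded_above)
           (auto simp: abs_mult intro!: mult_mono component_le_norm_cart bound)
      then have "norm (\<chi> i. \<Sum>j\<in>UNIV. h $ j * A j i y) \<le> n * (n * (norm h * M))"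
        unfolding n_def by (intro order_trans[OF norm_le_l1_cart] sum_bounded_above) simp
      then show ?thesis by (simp add: B_def ac_simps)
    qed
    \<comment> \<open>The mean value inequality on the whole space, with \<open>B\<close> as a bound
      for the operator norm of the derivative of \<open>v\<close>.\<close>
    then have "norm (v x - v 0) \<le> B * norm (x - 0)"
      by (intro differentiable_bound[of UNIV v "\<lambda>x h. \<chi> i. \<Sum>j\<in>UNIV. h $ j * A j i x"] dv onorm_le) auto
    then have "norm (u x) \<le> norm (v 0) + B * norm x + \<bar>b\<bar> * norm x"
      unfolding u_def using norm_triangle_ineq4[of "v x" "b *\<^sub>R x"] norm_triangle_sub[of "v x" "v 0"]
      by simp
    also have "\<dots> \<le> (norm (v 0) + B + \<bar>b\<bar>) * (1 + norm x)"
      using n M by (simp add: algebra_simps B_def)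
    finally show ?thesis .
  qed
  \<comment> \<open>The three bounds secure \<open>\<theta> \<le> 1\<close>,
    \<open>\<theta> < r\<close> and \<open>C * \<theta> < \<bar>c\<bar>\<close>; the denominator
    uses \<open>C + 1\<close> because \<open>C\<close> may be 0.\<close>
  define \<theta> where "\<theta> = min 1 (min (r / 2) (\<bar>c\<bar> / (2 * (C + 1))))"
  have \<theta>: "0 < \<theta>" "\<theta> \<le> 1" "\<theta> < r" "C * \<theta> < \<bar>c\<bar>"
  proof -
    show "0 < \<theta>" "\<theta> \<le> 1" "\<theta> < r"
      using \<open>r > 0\<close> C c by (auto simp: \<theta>_def min_less_iff_disj)
    have "C * \<theta> \<le> C * (\<bar>c\<bar> / (2 * (C + 1)))"
      using C by (intro mult_left_mono) (auto simp: \<theta>_def)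
    also have "\<dots> < \<bar>c\<bar>"
      using C c by (simp add: field_simps) (simp add: add_nonneg_pos)
    finally show "C * \<theta> < \<bar>c\<bar>" .
  qed
  have "s x = 0"
  proof (rule transport_powr_integrable_vanishes[OF ds _ du _ div_u _ transport growth C \<theta>(1,2,4)])
    show "continuous_on UNIV (\<lambda>x. s' x h)" "continuous_on UNIV (\<lambda>x. u' x h)" for h
      unfolding s'_def u'_def by (intro continuous_intros cont_W cont_W' cont_A)+
    show "0 \<le> s x" for x
      by (simp add: s_def sum_nonneg)
    show "integrable lebesgue (\<lambda>x. s x powr \<theta>)"
      unfolding s_def W_def by (rule int[OF \<theta>(1,3)])
  qed
  then have "W k i x = 0"
    by (simp add: s_def sum_nonneg_eq_0_iff sum_nonneg)
  then show ?thesis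
    by (simp add: W_def)
qed

section \<open>Curl-free and divergence-free fields\<close>

text \<open>The symmetric Jacobian yields a potential whose partial derivatives are the components
  of \<open>v\<close>, so its Laplacian is the divergence of \<open>v\<close>.\<close>

lemma irrotational_solenoidal_imp_harmonic_gradient:
  fixes v :: "real ^ 'n \<Rightarrow> real ^ 'n"
  assumes v: "Ck_field 2 v"
    and sym: "\<And>j i x. partial_deriv j (\<lambda>y. v y $ i) x = partial_deriv i (\<lambda>y. v y $ j) x"
    and div: "\<And>x. div_field v x = 0"
  obtains h where "harmonic h" "v = grad h"
proof -
  define A where "A j i = partial_deriv j (\<lambda>y. v y $ i)" for j i
  have C2: "Ck 2 (\<lambda>y. v y $ i)" for i
    using v by (simp add: Ck_field_def)
  have cont_A: "continuous_on UNIV (A j i)" for j i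
    unfolding A_def using Ck_2D(2)[OF C2]
    by (intro differentiable_imp_continuous_on) (simp add: differentiable_on_def)
  have "\<exists>h. \<forall>x. (h has_derivative (\<lambda>k. v x \<bullet> k)) (at x)"
  proof (rule symmetric_derivative_imp_gradient)
    show "(v has_derivative (\<lambda>h. \<chi> i. \<Sum>j\<in>UNIV. h $ j * A j i x)) (at x)" for x
      unfolding A_def by (rule has_derivative_field[OF Ck_2D(1)[OF C2]])
    show "continuous_on UNIV (\<lambda>(x, h). \<chi> i. \<Sum>j\<in>UNIV. h $ j * A j i x)"
      unfolding split_beta by (intro continuous_intros continuous_on_compose2[OF cont_A]) auto
    show "(\<chi> i. \<Sum>j\<in>UNIV. h $ j * A j i x) \<bullet> k = (\<chi> i. \<Sum>j\<in>UNIV. k $ j * A j i x) \<bullet> h" for x h k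
    proof -
      have "(\<chi> i. \<Sum>j\<in>UNIV. h $ j * A j i x) \<bullet> k = (\<Sum>i\<in>UNIV. \<Sum>j\<in>UNIV. h $ j * A j i x * k $ i)"
        by (simp add: inner_vec_def sum_distrib_right)
      also have "\<dots> = (\<Sum>j\<in>UNIV. \<Sum>i\<in>UNIV. h $ j * A i j x * k $ i)"
        using sym by (subst sum.swap) (simp add: A_def)
      also have "\<dots> = (\<chi> i. \<Sum>j\<in>UNIV. k $ j * A j i x) \<bullet> h"
        by (simp add: inner_vec_def sum_distrib_left ac_simps)
      finally show ?thesis .
    qed
  qed blast
  then obtain h where h: "\<And>x. (h has_derivative (\<lambda>k. v x \<bullet> k)) (at x)"
    by blast
  have ph: "partial_deriv i h = (\<lambda>x. v x $ i)" for i
    by (rule ext) (simp add: partial_deriv_has_derivative[OF h] inner_axis)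
  have "h differentiable (at x)" for x
    using h by (auto simp: differentiable_def)
  then have "Ck 2 h"
    using Ck_2D(1)[OF C2] cont_A
    by (auto simp: numeral_2_eq_2 ph differentiable_on_def A_def)
  moreover have "laplacian h x = 0" for x
    using div[of x] by (simp add: laplacian_def ph div_field_def)
  moreover have "v = grad h"
    by (simp add: fun_eq_iff grad_def ph)
  ultimately show ?thesis
    using that[of h] by (simp add: harmonic_def)
qed

text \<open>Each component is harmonic: by \<open>sym\<close> and the exchange of derivatives, the
  Laplacian of the \<open>i\<close>-th component is the \<open>i\<close>-th derivative of
  \<open>div_field v\<close>. The maximum principle then applies componentwise.\<close>

lemma irrotational_solenoidal_decay_zero:
  fixes v :: "real ^ 'n \<Rightarrow> real ^ 'n"
  assumes v: "Ck_field 2 v"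
    and sym: "\<And>j i x. partial_deriv j (\<lambda>y. v y $ i) x = partial_deriv i (\<lambda>y. v y $ j) x"
    and div: "\<And>x. div_field v x = 0"
    and lim: "((\<lambda>x. norm (v x)) \<longlongrightarrow> 0) at_infinity"
  shows "v x = 0"
proof -
  have C2: "Ck 2 (\<lambda>y. v y $ i)" for i
    using v by (simp add: Ck_field_def)
  have "v x $ i = 0" for i
  proof (rule harmonic_decay_zero[OF C2])
    show "((\<lambda>x. v x $ i) \<longlongrightarrow> 0) at_infinity"
      using tendsto_norm_zero_cancel[OF lim] by (auto dest: tendsto_vec_nth[of _ 0 _ i])
    fix x
    have eq: "partial_deriv j (\<lambda>y. v y $ i) = partial_deriv i (\<lambda>y. v y $ j)" for j
      by (rule ext) (rule sym)
    have "partial_deriv j (partial_deriv j (\<lambda>y. v y $ i)) x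
        = partial_deriv j (partial_deriv i (\<lambda>y. v y $ j)) x" for j
      by (simp only: eq[of j])
    then have "laplacian (\<lambda>y. v y $ i) x = (\<Sum>j\<in>UNIV. partial_deriv j (partial_deriv i (\<lambda>y. v y $ j)) x)"
      by (simp add: laplacian_def)
    also have "\<dots> = (\<Sum>j\<in>UNIV. partial_deriv i (partial_deriv j (\<lambda>y. v y $ j)) x)"
      by (intro sum.cong Ck_2D(4)[OF C2] refl)
    also have "\<dots> = partial_deriv i (div_field v) x"
      unfolding div_field_def by (intro partial_deriv_sum[symmetric] Ck_2D(2)[OF C2])
    also have "\<dots> = 0"
      using div by (simp add: partial_deriv_def)
    finally show "laplacian (\<lambda>y. v y $ i) x = 0" .
  qed
  then show ?thesis
    by (simp add: vec_eq_iff)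
qed

section \<open>The three-dimensional case\<close>

text \<open>Every component of the curl occurs twice in the antisymmetric matrix, with opposite
  signs, and the diagonal is zero.\<close>

lemma sum_antisymmetric_eq_curl:
  "(\<Sum>k\<in>UNIV. \<Sum>i\<in>UNIV. (partial_deriv k (\<lambda>y. v y $ i) x - partial_deriv i (\<lambda>y. v y $ k) x)\<^sup>2)
    = 2 * (norm (curl v x))\<^sup>2"
  unfolding power2_norm_eq_inner
  by (simp add: curl_def inner_vec_def sum_3 power2_eq_square algebra_simps)

theorem theoremA1:
  fixes a b :: real
    and v :: "real ^ 3 \<Rightarrow> real ^ 3"
    and p :: "real ^ 3 \<Rightarrow> real"
  assumes "b \<noteq> 0"
    and "Ck_field 2 v"
    and "p differentiable_on UNIV"
    and "\<And>x. advect v v x = - grad p x + a *\<^sub>R v x + b *\<^sub>R advect (\<lambda>y. y) v x"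
    and "\<And>x. div_field v x = 0"
    and "esssup lebesgue (\<lambda>x. ereal (norm (grad_field v x))) < \<infinity>"
    and "curl v \<in> (\<Union>r\<in>{0<..}. \<Inter>q\<in>{0<..<r}. Lq q)"
  shows "(\<exists>h. harmonic h \<and> v = grad h) \<and>
         (((\<lambda>x. norm (v x)) \<longlongrightarrow> 0) at_infinity \<longrightarrow> v = (\<lambda>x. 0))"
proof -
  have C2: "Ck 2 (\<lambda>y. v y $ i)" for i
    using assms(2) by (simp add: Ck_field_def)
  have cont: "continuous_on UNIV (partial_deriv j (\<lambda>y. v y $ i))" for j i
    using Ck_2D(2)[OF C2]
    by (intro differentiable_imp_continuous_on) (simp add: differentiable_on_def)
  obtain M where M: "esssup lebesgue (\<lambda>x. ereal (norm (grad_field v x))) < ereal M"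
    using assms(6) less_PInf_Ex_of_nat[of "esssup lebesgue (\<lambda>x. ereal (norm (grad_field v x)))"]
    by auto
  have ae: "AE x in lebesgue. x \<notin> {x. M < norm (grad_field v x)}"
    using esssup_AE[of "\<lambda>x. ereal (norm (grad_field v x))" lebesgue]
  proof eventually_elim
    case (elim x)
    then have "ereal (norm (grad_field v x)) < ereal M"
      using M by (rule le_less_trans)
    then show ?case by simp
  qed
  have "open {x. M < norm (grad_field v x)}"
    unfolding grad_field_def by (intro open_Collect_less continuous_intros cont)
  then have "norm (grad_field v x) \<le> M" for x
    using AE_lebesgue_open_empty[OF _ ae] by (auto simp: not_less[symmetric])
  then have bound: "\<bar>partial_deriv j (\<lambda>y. v y $ i) x\<bar> \<le> M" for j i x
    using component_le_norm_cart[of "grad_field v x $ i" j] Finite_Cartesian_Product.norm_nth_le[of "grad_field v x" i]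
    by (auto simp: grad_field_def intro: order_trans)
  obtain r where r: "r > 0" "\<And>q. 0 < q \<Longrightarrow> q < r \<Longrightarrow> curl v \<in> Lq q"
    using assms(7) by auto
  have sym: "partial_deriv j (\<lambda>y. v y $ i) x = partial_deriv i (\<lambda>y. v y $ j) x" for j i x
  proof (rule self_similar_irrotational[OF assms(1-5) bound])
    show "0 < r / 2" using r by simp
    fix \<theta> :: real assume \<theta>: "0 < \<theta>" "\<theta> < r / 2"
    \<comment> \<open>The matrix norm enters squared, so the exponent \<open>\<theta>\<close>
      corresponds to \<open>q = 2 * \<theta>\<close> for the curl; this is why the range ends at
      \<open>r / 2\<close>.\<close>
    have "(2 * (norm (curl v x))\<^sup>2) powr \<theta> = 2 powr \<theta> * norm (curl v x) powr (2 * \<theta>)" for x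
      by (cases "curl v x = 0") (simp_all add: powr_mult flip: powr_powr)
    then show "integrable lebesgue (\<lambda>x. (\<Sum>k\<in>UNIV. \<Sum>i\<in>UNIV.
        (partial_deriv k (\<lambda>y. v y $ i) x - partial_deriv i (\<lambda>y. v y $ k) x)\<^sup>2) powr \<theta>)"
      using r(2)[of "2 * \<theta>"] \<theta> unfolding sum_antisymmetric_eq_curl by (simp add: Lq_def)
  qed
  obtain h where "harmonic h" "v = grad h"
    using irrotational_solenoidal_imp_harmonic_gradient[OF assms(2) sym assms(5)] .
  moreover have "v = (\<lambda>x. 0)" if "((\<lambda>x. norm (v x)) \<longlongrightarrow> 0) at_infinity"
    using irrotational_solenoidal_decay_zero[OF assms(2) sym assms(5) that] by blast
  ultimately show ?thesis by blast
qed

end
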